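(* Let $n$ be a positive integer, $x\in\mathbb{B}^n\setminus\{0\}$ and $0<k<1$. For $y\in\mathbb{B}^n\setminus\{0\}$ let $$\Upsilon_{\mathbb{B}^n}(x,y)=\frac{|x-y|}{|x-y|+2-2|y|},\qquad S_\Upsilon(x,k)=\{y\in\mathbb{B}^n\setminus\{0\} : \Upsilon_{\mathbb{B}^n}(x,y)=k\},$$ and let $u=u(y)\in[0,\pi]$ denote the angle at the origin between the vectors $x$ and $y$. Define $$c_0=\frac{4k^2-\sqrt{(3k^2+2k-1)(4k^2-|x|^2(1-k)^2)}}{|x|(1-k)^2},\qquad c_1=\frac{4k^2+\sqrt{(3k^2+2k-1)(4k^2-|x|^2(1-k)^2)}}{|x|(1-k)^2},$$ $$l_0(u)=\frac{4k^2-(1-k)^2|x|\cos(u)-(1-k)\sqrt{4k^2(1+|x|^2-2|x|\cos(u))-(1-k)^2|x|^2\sin^2(u)}}{3k^2+2k-1},$$ $$l_1(u)=\frac{4k^2-(1-k)^2|x|\cos(u)+(1-k)\sqrt{4k^2(1+|x|^2-2|x|\cos(u))-(1-k)^2|x|^2\sin^2(u)}}{3k^2+2k-1}.$$ Then: (i) if $k=\frac13$, then $S_\Upsilon(x,k)=\left\{y\in\mathbb{B}^n\setminus\{0\} : |y|=\dfrac{1-|x|^2}{2(1-|x|\cos(u))}\right\}$; (ii) if $k<\frac13$ and $|x|<\frac{2k}{1-k}$, then $S_\Upsilon(x,k)=\{y\in\mathbb{B}^n\setminus\{0\} : |y|=l_0(u)\}$; (iii) if $k<\frac13$ and $|x|>\frac{2k}{1-k}$,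 then $S_\Upsilon(x,k)=\{y\in\mathbb{B}^n\setminus\{0\} : |y|\in\{l_0(u),l_1(u)\},\ \cos(u)\geq c_1\}$; (iv) if $k>\frac13$, then $S_\Upsilon(x,k)=\{y\in\mathbb{B}^n\setminus\{0\} : |y|=l_0(u),\ \cos(u)\leq c_0\}$.
   Context: $\mathbb{B}^n$ is the open Euclidean unit ball of $\mathbb{R}^n$ and $|\cdot|$ is the Euclidean norm. The quantities $c_0,c_1$ and $l_0(u),l_1(u)$ are only used in the cases in which they appear. *)

theory Defs
  imports "HOL-Analysis.Analysis"
begin

definition punctured_ball :: "(real ^ 'n) set" where
  "punctured_ball = ball 0 1 - {0}"

definition Upsilon :: "real ^ 'n \<Rightarrow> real ^ 'n \<Rightarrow> real" where
  "Upsilon x y = norm (x - y) / (norm (x - y) + 2 - 2 * norm y)"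

definition S_Upsilon :: "real ^ 'n \<Rightarrow> real \<Rightarrow> (real ^ 'n) set" where
  "S_Upsilon x k = {y \<in> punctured_ball. Upsilon x y = k}"

(* The angle at the origin between two nonzero vectors; arccos takes values in [0, pi]. *)
definition angle :: "real ^ 'n \<Rightarrow> real ^ 'n \<Rightarrow> real" where
  "angle x y = arccos (inner x y / (norm x * norm y))"

(* In c0, c1, l0, l1 the argument r stands for the norm of the fixed point x. At k = 1/3 the
   denominator of l0 and l1 vanishes, and sqrt is the library's odd extension to negative
   arguments; neither convention plays a role in the cases where these quantities are used. *)

definition c0 :: "real \<Rightarrow> real \<Rightarrow> real" where
  "c0 r k =
    (4 * k\<^sup>2 - sqrt ((3 * k\<^sup>2 + 2 * k - 1) * (4 * k\<^sup>2 - r\<^sup>2 * (1 - k)\<^sup>2)))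
      / (r * (1 - k)\<^sup>2)"

definition c1 :: "real \<Rightarrow> real \<Rightarrow> real" where
  "c1 r k =
    (4 * k\<^sup>2 + sqrt ((3 * k\<^sup>2 + 2 * k - 1) * (4 * k\<^sup>2 - r\<^sup>2 * (1 - k)\<^sup>2)))
      / (r * (1 - k)\<^sup>2)"

definition l0 :: "real \<Rightarrow> real \<Rightarrow> real \<Rightarrow> real" where
  "l0 r k u =
    (4 * k\<^sup>2 - (1 - k)\<^sup>2 * r * cos u
      - (1 - k) * sqrt (4 * k\<^sup>2 * (1 + r\<^sup>2 - 2 * r * cos u)
                        - (1 - k)\<^sup>2 * r\<^sup>2 * (sin u)\<^sup>2))
      / (3 * k\<^sup>2 + 2 * k - 1)"

definition l1 :: "real \<Rightarrow> real \<Rightarrow> real \<Rightarrow> real" where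
  "l1 r k u =
    (4 * k\<^sup>2 - (1 - k)\<^sup>2 * r * cos u
      + (1 - k) * sqrt (4 * k\<^sup>2 * (1 + r\<^sup>2 - 2 * r * cos u)
                        - (1 - k)\<^sup>2 * r\<^sup>2 * (sin u)\<^sup>2))
      / (3 * k\<^sup>2 + 2 * k - 1)"

end

theory Submission
  imports Defs
begin

text \<open>
  Clearing the denominator of \<open>Upsilon x y = k\<close> gives \<open>(1 - k) |x - y| = 2 k (1 - |y|)\<close>, and both
  sides are nonnegative, so nothing is lost by squaring. With \<open>r = |x|\<close>, \<open>t = |y|\<close> and \<open>u\<close> the angle
  at the origin, the law of cosines turns this into a quadratic equation
  \<open>A t\<^sup>2 - 2 B t + P = 0\<close>, where \<open>A = 3 k\<^sup>2 + 2 k - 1 = (3 k - 1) (k + 1)\<close>,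
  \<open>B = 4 k\<^sup>2 - (1 - k)\<^sup>2 r cos u\<close> and \<open>P = 4 k\<^sup>2 - (1 - k)\<^sup>2 r\<^sup>2\<close>.
  Its formal roots are \<open>l0\<close> and \<open>l1\<close>, and it is linear exactly when \<open>k = 1/3\<close>.

  The remaining cases differ in which roots can lie in \<open>(0, 1)\<close>, which the signs of the coefficients
  decide. If \<open>A < 0 < P\<close>, the product of the roots is negative and \<open>l0\<close> is the positive one. If
  \<open>A\<close> and \<open>P\<close> are both negative, the roots have the same sign, and they are real and positive
  exactly when \<open>B \<le> - sqrt (A P)\<close>; this is the condition \<open>cos u \<ge> c1\<close>. If \<open>A > 0\<close>, then also
  \<open>P > 0\<close>, and the value of the quadratic at \<open>t = 1\<close> is negative, so exactly one root, the smaller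
  one \<open>l0\<close>, lies in \<open>(0, 1)\<close>; the condition \<open>cos u \<le> c0\<close>, that is \<open>B \<ge> sqrt (A P)\<close>, says that
  the roots are real and positive.
\<close>

section \<open>Roots of a real quadratic in prescribed ranges\<close>

lemma quadratic_roots:
  fixes A B P t :: real
  assumes "A \<noteq> 0" and "A * P \<le> B\<^sup>2"
  shows "A * t\<^sup>2 - 2 * B * t + P = 0 \<longleftrightarrow>
    t = (B - sqrt (B\<^sup>2 - A * P)) / A \<or> t = (B + sqrt (B\<^sup>2 - A * P)) / A"
proof -
  define s where "s = sqrt (B\<^sup>2 - A * P)"
  have s2: "s\<^sup>2 = B\<^sup>2 - A * P"
    using assms(2) by (simp add: s_def)
  have "A * (A * t\<^sup>2 - 2 * B * t + P) = (A * t - B)\<^sup>2 - s\<^sup>2"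
    unfolding s2 by (simp add: power2_eq_square algebra_simps)
  then have "A * t\<^sup>2 - 2 * B * t + P = 0 \<longleftrightarrow> (A * t - B)\<^sup>2 = s\<^sup>2"
    using assms(1) by (metis eq_iff_diff_eq_0 mult_eq_0_iff)
  also have "\<dots> \<longleftrightarrow> A * t - B = s \<or> A * t - B = - s"
    by (rule power2_eq_iff)
  also have "\<dots> \<longleftrightarrow> t = (B - s) / A \<or> t = (B + s) / A"
    using assms(1) by (auto simp: field_simps)
  finally show ?thesis
    by (simp add: s_def)
qed

lemma quadratic_root_imp_discriminant_nonneg:
  fixes A B P t :: real
  assumes "A * t\<^sup>2 - 2 * B * t + P = 0"
  shows "A * P \<le> B\<^sup>2"
proof -
  have P: "P = 2 * B * t - A * t\<^sup>2"
    using assms by simp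
  have "B\<^sup>2 - A * P = (A * t - B)\<^sup>2"
    unfolding P by (simp add: power2_eq_square algebra_simps)
  then show ?thesis
    by (metis diff_ge_0_iff_ge zero_le_power2)
qed

text \<open>
  The product \<open>P / A\<close> of the roots is negative, so exactly one root is positive; since \<open>A < 0\<close>, it is
  the one with the negative numerator.
\<close>

lemma quadratic_positive_root_iff:
  fixes A B P t :: real
  assumes "A < 0" and "0 < P" and "0 < t"
  shows "A * t\<^sup>2 - 2 * B * t + P = 0 \<longleftrightarrow> t = (B - sqrt (B\<^sup>2 - A * P)) / A"
proof -
  have AP: "A * P < 0"
    using assms by (simp add: mult_neg_pos)
  then have disc: "A * P \<le> B\<^sup>2"
    by (smt (verit) zero_le_power2)
  have "sqrt (B\<^sup>2) < sqrt (B\<^sup>2 - A * P)"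
    using AP by (intro real_sqrt_less_mono) simp
  then have "0 < B + sqrt (B\<^sup>2 - A * P)"
    by simp
  then have "(B + sqrt (B\<^sup>2 - A * P)) / A < 0"
    using assms(1) by (rule divide_pos_neg)
  then show ?thesis
    using quadratic_roots[of A P B t] disc assms by auto
qed

text \<open>
  Here the roots have the same sign, so a positive root forces both to be positive, that is \<open>B \<le> 0\<close>.
  The bound on \<open>B\<close> combines this with the nonnegativity of the discriminant.
\<close>

lemma quadratic_positive_roots_iff:
  fixes A B P t :: real
  assumes "A < 0" and "P < 0" and "0 < t"
  shows "A * t\<^sup>2 - 2 * B * t + P = 0 \<longleftrightarrow>
    t \<in> {(B - sqrt (B\<^sup>2 - A * P)) / A, (B + sqrt (B\<^sup>2 - A * P)) / A} \<and> B \<le> - sqrt (A * P)"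
proof
  assume root: "A * t\<^sup>2 - 2 * B * t + P = 0"
  have disc: "A * P \<le> B\<^sup>2"
    using root by (rule quadratic_root_imp_discriminant_nonneg)
  have "A * t\<^sup>2 < 0"
    using assms by (simp add: mult_neg_pos)
  then have "B * t < 0"
    using root assms(2) by linarith
  then have "B < 0"
    using assms(3) by (simp add: mult_less_0_iff)
  moreover have "sqrt (A * P) \<le> sqrt (B\<^sup>2)"
    using disc by (rule real_sqrt_le_mono)
  ultimately show "t \<in> {(B - sqrt (B\<^sup>2 - A * P)) / A, (B + sqrt (B\<^sup>2 - A * P)) / A}
      \<and> B \<le> - sqrt (A * P)"
    using quadratic_roots[of A P B t] disc assms root by auto
next
  assume rhs: "t \<in> {(B - sqrt (B\<^sup>2 - A * P)) / A, (B + sqrt (B\<^sup>2 - A * P)) / A}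
    \<and> B \<le> - sqrt (A * P)"
  have AP: "0 < A * P"
    using assms by (simp add: mult_neg_neg)
  have "(sqrt (A * P))\<^sup>2 \<le> (- B)\<^sup>2"
    using rhs AP by (intro power_mono) auto
  then have "A * P \<le> B\<^sup>2"
    using AP by simp
  then show "A * t\<^sup>2 - 2 * B * t + P = 0"
    using quadratic_roots[of A P B t] assms rhs by auto
qed

text \<open>
  The quadratic is convex and negative at \<open>1\<close>, so \<open>1\<close> lies strictly between the roots and only the
  smaller root can be below \<open>1\<close>.
\<close>

lemma quadratic_root_below_one_iff:
  fixes A B P t :: real
  assumes "0 < A" and "0 < P" and neg1: "A - 2 * B + P < 0" and "0 < t" and "t < 1"
  shows "A * t\<^sup>2 - 2 * B * t + P = 0 \<longleftrightarrow>
    t = (B - sqrt (B\<^sup>2 - A * P)) / A \<and> sqrt (A * P) \<le> B"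
proof -
  have B: "A + P < 2 * B"
    using neg1 by simp
  have AP: "0 < A * P"
    using assms by simp
  have "(A - P)\<^sup>2 + 4 * (A * P) = (A + P)\<^sup>2"
    by (simp add: power2_eq_square algebra_simps)
  moreover have "(A + P)\<^sup>2 \<le> (2 * B)\<^sup>2"
    using B assms by (intro power_mono) auto
  ultimately have disc: "A * P \<le> B\<^sup>2"
    by (simp add: power_mult_distrib) (smt (verit) zero_le_power2)
  have "sqrt (A * P) \<le> sqrt (B\<^sup>2)"
    using disc by (rule real_sqrt_le_mono)
  then have sqrt_le: "sqrt (A * P) \<le> B"
    using B assms by simp
  \<comment> \<open>Rewritten as \<open>(A - B)\<^sup>2 < B\<^sup>2 - A P\<close>, negativity at \<open>1\<close> bounds the larger root from below.\<close>
  have "A * (A - 2 * B + P) < 0"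
    using assms by (simp add: mult_pos_neg)
  then have "(A - B)\<^sup>2 < B\<^sup>2 - A * P"
    by (simp add: power2_eq_square algebra_simps)
  then have "A - B < sqrt (B\<^sup>2 - A * P)"
    by (rule real_less_rsqrt)
  then have "1 < (B + sqrt (B\<^sup>2 - A * P)) / A"
    using assms by (simp add: field_simps)
  then show ?thesis
    using quadratic_roots[of A P B t] disc sqrt_le assms by auto
qed

section \<open>The level set as a quadratic equation in the norm\<close>

lemma mem_punctured_ball_iff: "y \<in> punctured_ball \<longleftrightarrow> 0 < norm y \<and> norm y < 1"
  by (auto simp: punctured_ball_def)

lemma inner_eq_norm_cos_angle:
  fixes x y :: "real ^ 'n"
  assumes "x \<noteq> 0" and "y \<noteq> 0"
  shows "inner x y = norm x * norm y * cos (angle x y)"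
proof -
  have "\<bar>inner x y / (norm x * norm y)\<bar> \<le> 1"
    using assms Cauchy_Schwarz_ineq2[of x y] by (simp add: abs_mult divide_le_eq)
  then have "cos (angle x y) = inner x y / (norm x * norm y)"
    unfolding angle_def by (intro cos_arccos) linarith+
  then show ?thesis
    using assms by simp
qed

lemma Upsilon_eq_iff_quadratic:
  fixes x y :: "real ^ 'n" and k :: real
  assumes x: "x \<in> punctured_ball" and y: "y \<in> punctured_ball" and k: "0 < k" "k < 1"
  shows "Upsilon x y = k \<longleftrightarrow>
    (3 * k\<^sup>2 + 2 * k - 1) * (norm y)\<^sup>2
      - 2 * (4 * k\<^sup>2 - (1 - k)\<^sup>2 * norm x * cos (angle x y)) * norm y
      + (4 * k\<^sup>2 - (1 - k)\<^sup>2 * (norm x)\<^sup>2) = 0"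
proof -
  define d where "d = norm (x - y)"
  define r where "r = norm x"
  define t where "t = norm y"
  define c where "c = cos (angle x y)"
  have t: "0 < t" "t < 1" and d: "0 \<le> d"
    using y by (auto simp: mem_punctured_ball_iff t_def d_def)
  have "x \<noteq> 0" "y \<noteq> 0"
    using x y by (auto simp: punctured_ball_def)
  then have ip: "inner x y = r * t * c"
    using inner_eq_norm_cos_angle by (simp add: r_def t_def c_def)
  have d2: "d\<^sup>2 = r\<^sup>2 + t\<^sup>2 - 2 * r * t * c"
    using ip by (simp add: d_def r_def t_def power2_norm_eq_inner inner_diff_left
        inner_diff_right inner_commute)
  have "Upsilon x y = k \<longleftrightarrow> d = k * (d + 2 - 2 * t)"
    unfolding Upsilon_def d_def[symmetric] t_def[symmetric]
    using d t by (simp add: divide_eq_eq)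
  also have "\<dots> \<longleftrightarrow> (1 - k) * d = 2 * k * (1 - t)"
    by (auto simp: algebra_simps)
  also have "\<dots> \<longleftrightarrow> ((1 - k) * d)\<^sup>2 = (2 * k * (1 - t))\<^sup>2"
    using d k t by (intro power2_eq_iff_nonneg[symmetric]) auto
  also have "\<dots> \<longleftrightarrow> (1 - k)\<^sup>2 * (r\<^sup>2 + t\<^sup>2 - 2 * r * t * c) = 4 * k\<^sup>2 * (1 - t)\<^sup>2"
    by (simp add: power_mult_distrib d2)
  also have "\<dots> \<longleftrightarrow> (3 * k\<^sup>2 + 2 * k - 1) * t\<^sup>2 - 2 * (4 * k\<^sup>2 - (1 - k)\<^sup>2 * r * c) * t
      + (4 * k\<^sup>2 - (1 - k)\<^sup>2 * r\<^sup>2) = 0"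
    by (auto simp: power2_eq_square algebra_simps)
  finally show ?thesis
    by (simp add: r_def t_def c_def)
qed

text \<open>
  Because \<open>3 k\<^sup>2 + 2 k - 1 = 4 k\<^sup>2 - (1 - k)\<^sup>2\<close>, the discriminant is divisible by \<open>(1 - k)\<^sup>2\<close>; the
  radicand in \<open>l0\<close> and \<open>l1\<close> is the quotient.
\<close>

lemma sqrt_discriminant:
  fixes r k u :: real
  assumes "k < 1"
  shows "sqrt ((4 * k\<^sup>2 - (1 - k)\<^sup>2 * r * cos u)\<^sup>2
      - (3 * k\<^sup>2 + 2 * k - 1) * (4 * k\<^sup>2 - (1 - k)\<^sup>2 * r\<^sup>2)) =
    (1 - k) * sqrt (4 * k\<^sup>2 * (1 + r\<^sup>2 - 2 * r * cos u) - (1 - k)\<^sup>2 * r\<^sup>2 * (sin u)\<^sup>2)"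
proof -
  have A: "3 * k\<^sup>2 + 2 * k - 1 = 4 * k\<^sup>2 - (1 - k)\<^sup>2"
    by (simp add: power2_eq_square algebra_simps)
  have "(4 * k\<^sup>2 - (1 - k)\<^sup>2 * r * cos u)\<^sup>2
      - (3 * k\<^sup>2 + 2 * k - 1) * (4 * k\<^sup>2 - (1 - k)\<^sup>2 * r\<^sup>2) =
    (1 - k)\<^sup>2 * (4 * k\<^sup>2 * (1 + r\<^sup>2 - 2 * r * cos u) - (1 - k)\<^sup>2 * r\<^sup>2 * (1 - (cos u)\<^sup>2))"
    unfolding A by algebra
  then show ?thesis
    using assms by (simp add: sin_squared_eq real_sqrt_mult)
qed

lemma l0_eq_root:
  assumes "k < 1"
  shows "l0 r k u =
    (4 * k\<^sup>2 - (1 - k)\<^sup>2 * r * cos u - sqrt ((4 * k\<^sup>2 - (1 - k)\<^sup>2 * r * cos u)\<^sup>2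
      - (3 * k\<^sup>2 + 2 * k - 1) * (4 * k\<^sup>2 - (1 - k)\<^sup>2 * r\<^sup>2))) / (3 * k\<^sup>2 + 2 * k - 1)"
  unfolding sqrt_discriminant[OF assms] l0_def ..

lemma l1_eq_root:
  assumes "k < 1"
  shows "l1 r k u =
    (4 * k\<^sup>2 - (1 - k)\<^sup>2 * r * cos u + sqrt ((4 * k\<^sup>2 - (1 - k)\<^sup>2 * r * cos u)\<^sup>2
      - (3 * k\<^sup>2 + 2 * k - 1) * (4 * k\<^sup>2 - (1 - k)\<^sup>2 * r\<^sup>2))) / (3 * k\<^sup>2 + 2 * k - 1)"
  unfolding sqrt_discriminant[OF assms] l1_def ..

lemma c0_ge_iff:
  assumes "0 < r" and "k < 1"
  shows "c \<le> c0 r k \<longleftrightarrow>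
    sqrt ((3 * k\<^sup>2 + 2 * k - 1) * (4 * k\<^sup>2 - (1 - k)\<^sup>2 * r\<^sup>2)) \<le> 4 * k\<^sup>2 - (1 - k)\<^sup>2 * r * c"
proof -
  have "0 < r * (1 - k)\<^sup>2"
    using assms by simp
  then show ?thesis
    unfolding c0_def by (subst pos_le_divide_eq) (auto simp: mult.commute mult.left_commute)
qed

lemma c1_le_iff:
  assumes "0 < r" and "k < 1"
  shows "c1 r k \<le> c \<longleftrightarrow>
    4 * k\<^sup>2 - (1 - k)\<^sup>2 * r * c \<le> - sqrt ((3 * k\<^sup>2 + 2 * k - 1) * (4 * k\<^sup>2 - (1 - k)\<^sup>2 * r\<^sup>2))"
proof -
  have "0 < r * (1 - k)\<^sup>2"
    using assms by simp
  then show ?thesis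
    unfolding c1_def by (subst pos_divide_le_eq) (auto simp: mult.commute mult.left_commute)
qed

section \<open>Signs of the coefficients and the level set\<close>

lemma leading_coefficient_factor:
  fixes k :: real
  shows "3 * k\<^sup>2 + 2 * k - 1 = (3 * k - 1) * (k + 1)"
  by (simp add: power2_eq_square algebra_simps)

lemma constant_coefficient_pos_iff:
  fixes r k :: real
  assumes "0 < r" and "0 < k" and "k < 1"
  shows "0 < 4 * k\<^sup>2 - (1 - k)\<^sup>2 * r\<^sup>2 \<longleftrightarrow> r < 2 * k / (1 - k)"
proof -
  have "0 < 4 * k\<^sup>2 - (1 - k)\<^sup>2 * r\<^sup>2 \<longleftrightarrow> ((1 - k) * r)\<^sup>2 < (2 * k)\<^sup>2"
    by (simp add: power_mult_distrib)
  also have "\<dots> \<longleftrightarrow> (1 - k) * r < 2 * k"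
    unfolding not_le[symmetric] using assms by (subst power_mono_iff) auto
  also have "\<dots> \<longleftrightarrow> r < 2 * k / (1 - k)"
    using assms by (simp add: field_simps)
  finally show ?thesis .
qed

lemma constant_coefficient_neg_iff:
  fixes r k :: real
  assumes "0 < r" and "0 < k" and "k < 1"
  shows "4 * k\<^sup>2 - (1 - k)\<^sup>2 * r\<^sup>2 < 0 \<longleftrightarrow> 2 * k / (1 - k) < r"
proof -
  have "4 * k\<^sup>2 - (1 - k)\<^sup>2 * r\<^sup>2 < 0 \<longleftrightarrow> (2 * k)\<^sup>2 < ((1 - k) * r)\<^sup>2"
    by (simp add: power_mult_distrib)
  also have "\<dots> \<longleftrightarrow> 2 * k < (1 - k) * r"
    unfolding not_le[symmetric] using assms by (subst power_mono_iff) auto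
  also have "\<dots> \<longleftrightarrow> 2 * k / (1 - k) < r"
    using assms by (simp add: field_simps)
  finally show ?thesis .
qed

text \<open>
  At \<open>t = 1\<close> the quadratic equals \<open>- (1 - k)\<^sup>2\<close> times the squared distance from \<open>x\<close> to the point of
  the unit sphere in the direction of \<open>y\<close>, which is at least \<open>(1 - |x|)\<^sup>2\<close>.
\<close>

lemma quadratic_at_one_neg:
  fixes r k c :: real
  assumes "0 < r" and "r < 1" and "k < 1" and "c \<le> 1"
  shows "(3 * k\<^sup>2 + 2 * k - 1) - 2 * (4 * k\<^sup>2 - (1 - k)\<^sup>2 * r * c)
    + (4 * k\<^sup>2 - (1 - k)\<^sup>2 * r\<^sup>2) < 0"
proof -
  have "r * c \<le> r"
    using assms by (simp add: mult_left_le)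
  moreover have "0 < (1 - r)\<^sup>2"
    using assms by simp
  ultimately have "0 < 1 - 2 * (r * c) + r\<^sup>2"
    by (simp add: power2_eq_square algebra_simps)
  then have "0 < (1 - k)\<^sup>2 * (1 - 2 * (r * c) + r\<^sup>2)"
    using assms by simp
  then show ?thesis
    by (simp add: power2_eq_square algebra_simps)
qed

lemma S_Upsilon_eqI:
  assumes "\<And>y. y \<in> punctured_ball \<Longrightarrow> Upsilon x y = k \<longleftrightarrow> Q y"
  shows "S_Upsilon x k = {y \<in> punctured_ball. Q y}"
  using assms by (auto simp: S_Upsilon_def)

theorem theorem4p1:
  fixes x :: "real ^ 'n" and k :: real
  assumes "x \<in> punctured_ball" and "0 < k" and "k < 1"
  shows
    "(k = 1 / 3 \<longrightarrow>
        S_Upsilon x k =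
          {y \<in> punctured_ball.
            norm y = (1 - (norm x)\<^sup>2) / (2 * (1 - norm x * cos (angle x y)))}) \<and>
     (k < 1 / 3 \<and> norm x < 2 * k / (1 - k) \<longrightarrow>
        S_Upsilon x k =
          {y \<in> punctured_ball. norm y = l0 (norm x) k (angle x y)}) \<and>
     (k < 1 / 3 \<and> norm x > 2 * k / (1 - k) \<longrightarrow>
        S_Upsilon x k =
          {y \<in> punctured_ball.
            norm y \<in> {l0 (norm x) k (angle x y), l1 (norm x) k (angle x y)} \<and>
            cos (angle x y) \<ge> c1 (norm x) k}) \<and>
     (k > 1 / 3 \<longrightarrow>
        S_Upsilon x k =
          {y \<in> punctured_ball.
            norm y = l0 (norm x) k (angle x y) \<and>
            cos (angle x y) \<le> c0 (norm x) k})"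
proof (intro conjI impI; (elim conjE)?)
  have x: "0 < norm x" "norm x < 1"
    using assms(1) by (auto simp: mem_punctured_ball_iff)
  note quadratic = Upsilon_eq_iff_quadratic[OF assms(1) _ assms(2,3)]
  {
    assume k: "k = 1 / 3"
    show "S_Upsilon x k = {y \<in> punctured_ball.
        norm y = (1 - (norm x)\<^sup>2) / (2 * (1 - norm x * cos (angle x y)))}"
    proof (rule S_Upsilon_eqI)
      fix y :: "real ^ 'n"
      assume y: "y \<in> punctured_ball"
      have "norm x * cos (angle x y) \<le> norm x"
        by (simp add: mult_left_le)
      then have "0 < 1 - norm x * cos (angle x y)"
        using x(2) by linarith
      then show "Upsilon x y = k \<longleftrightarrow>
          norm y = (1 - (norm x)\<^sup>2) / (2 * (1 - norm x * cos (angle x y)))"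
        unfolding quadratic[OF y] unfolding k
        by (simp add: eq_divide_eq) (auto simp: power2_eq_square algebra_simps)
    qed
  next
    assume k: "k < 1 / 3" and r: "norm x < 2 * k / (1 - k)"
    have A: "3 * k\<^sup>2 + 2 * k - 1 < 0"
      unfolding leading_coefficient_factor using k assms(2) by (intro mult_neg_pos) auto
    have P: "0 < 4 * k\<^sup>2 - (1 - k)\<^sup>2 * (norm x)\<^sup>2"
      using constant_coefficient_pos_iff[OF x(1) assms(2,3)] r by simp
    show "S_Upsilon x k = {y \<in> punctured_ball. norm y = l0 (norm x) k (angle x y)}"
      unfolding l0_eq_root[OF assms(3)]
      using quadratic quadratic_positive_root_iff[OF A P]
      by (intro S_Upsilon_eqI) (simp only: mem_punctured_ball_iff)
  next
    assume k: "k < 1 / 3" and r: "2 * k / (1 - k) < norm x"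
    have A: "3 * k\<^sup>2 + 2 * k - 1 < 0"
      unfolding leading_coefficient_factor using k assms(2) by (intro mult_neg_pos) auto
    have P: "4 * k\<^sup>2 - (1 - k)\<^sup>2 * (norm x)\<^sup>2 < 0"
      using constant_coefficient_neg_iff[OF x(1) assms(2,3)] r by simp
    show "S_Upsilon x k = {y \<in> punctured_ball.
        norm y \<in> {l0 (norm x) k (angle x y), l1 (norm x) k (angle x y)} \<and>
        c1 (norm x) k \<le> cos (angle x y)}"
      unfolding l0_eq_root[OF assms(3)] l1_eq_root[OF assms(3)] c1_le_iff[OF x(1) assms(3)]
      using quadratic quadratic_positive_roots_iff[OF A P]
      by (intro S_Upsilon_eqI) (simp only: mem_punctured_ball_iff)
  next
    assume k: "1 / 3 < k"
    have A: "0 < 3 * k\<^sup>2 + 2 * k - 1"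
      unfolding leading_coefficient_factor using k by simp
    have "1 < 2 * k / (1 - k)"
      using k assms(3) by (simp add: field_simps)
    then have P: "0 < 4 * k\<^sup>2 - (1 - k)\<^sup>2 * (norm x)\<^sup>2"
      using constant_coefficient_pos_iff[OF x(1) assms(2,3)] x(2) by simp
    show "S_Upsilon x k = {y \<in> punctured_ball.
        norm y = l0 (norm x) k (angle x y) \<and> cos (angle x y) \<le> c0 (norm x) k}"
      unfolding l0_eq_root[OF assms(3)] c0_ge_iff[OF x(1) assms(3)]
      using quadratic
        quadratic_root_below_one_iff[OF A P quadratic_at_one_neg[OF x assms(3) cos_le_one]]
      by (intro S_Upsilon_eqI) (simp only: mem_punctured_ball_iff)
  }
qed

end
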